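(* Let $m,n$ be positive integers. The map $(\mathbf r,\mathbf d)\mapsto (d_1+m,\dots,d_n+m)$ is a bijection from the set $A(mK_n)$ of arithmetical structures on $mK_n$ to the set of $n$-tuples $(x_1,\dots,x_n)$ of positive integers satisfying \[\frac{1}{x_1}+\cdots+\frac{1}{x_n}=\frac{1}{m}.\]
   Context: $mK_n$ is the loopless graph on vertices $v_1,\dots,v_n$ with exactly $m$ edges between each pair of distinct vertices. An arithmetical structure on $mK_n$ is a pair $(\mathbf r,\mathbf d)\in\mathbb N^n\times\mathbb N^n$ of vectors of positive integers with $\gcd(r_1,\dots,r_n)=1$ and $r_id_i=m\sum_{j\ne i}r_j$ for all $i$. $A(mK_n)$ is the set of all such pairs (ordered tuples; vertices labeled).
   Formalization: The formal statement assumes n ≥ 2: for n = 1 the claim fails, since r_1 d_1 = 0 has no solution in positive integers, so A(mK_1) is empty, while 1/x_1 = 1/m has the solution x_1 = m. *)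

theory Defs
  imports Complex_Main "HOL-Analysis.Finite_Cartesian_Product"
begin

definition arithmetical_structures_mK :: "nat \<Rightarrow> ((nat ^ 'n) \<times> (nat ^ 'n)) set" where
  "arithmetical_structures_mK m =
    {(r, d). (\<forall>i. r $ i > 0) \<and> (\<forall>i. d $ i > 0) \<and>
       Gcd (range (\<lambda>i. r $ i)) = 1 \<and>
       (\<forall>i. r $ i * d $ i = m * (\<Sum>j\<in>UNIV - {i}. r $ j))}"

definition egyptian_solutions :: "nat \<Rightarrow> (nat ^ 'n) set" where
  "egyptian_solutions m =
    {x. (\<forall>i. x $ i > 0) \<and> (\<Sum>i\<in>UNIV. 1 / real (x $ i)) = 1 / real m}"

text \<open>
  For \<open>n = 1\<close> the single vertex forces \<open>d\<^sub>1 = 0\<close>, which is not positive, so there is no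
  arithmetical structure, whereas \<open>1 / x\<^sub>1 = 1 / m\<close> has the solution \<open>x\<^sub>1 = m\<close>. The
  correspondence therefore needs \<open>n \<ge> 2\<close>.
\<close>

lemma no_bij_card_1:
  assumes "m > 0" and "CARD('n::finite) = 1"
  shows "\<not> bij_betw f (arithmetical_structures_mK m :: ((nat ^ 'n) \<times> (nat ^ 'n)) set)
                      (egyptian_solutions m :: (nat ^ 'n) set)"
proof -
  obtain a :: 'n where a: "UNIV = {a}"
    using assms(2) by (auto simp: card_1_singleton_iff)
  have "(arithmetical_structures_mK m :: ((nat ^ 'n) \<times> (nat ^ 'n)) set) = {}"
  proof -
    have "r $ a * d $ a \<noteq> m * (\<Sum>j\<in>UNIV - {a}. r $ j)"
      if "r $ a > 0" "d $ a > 0" for r d :: "nat ^ 'n"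
      using that a by simp
    then show ?thesis unfolding arithmetical_structures_mK_def by blast
  qed
  moreover have "(\<chi> i. m) \<in> (egyptian_solutions m :: (nat ^ 'n) set)"
    using assms by (simp add: egyptian_solutions_def)
  ultimately show ?thesis by (auto simp: bij_betw_def)
qed

end

theory Submission
  imports Defs
begin

text \<open>
  Adding \<open>m r\<^sub>i\<close> to both sides of the defining equations turns them into
  \<open>r\<^sub>i (d\<^sub>i + m) = m S\<close> with \<open>S = r\<^sub>1 + \<dots> + r\<^sub>n\<close>. Hence \<open>x\<^sub>i = d\<^sub>i + m\<close> has reciprocal
  \<open>r\<^sub>i / (m S)\<close>, and these add up to \<open>1 / m\<close>. Conversely \<open>x\<close> determines \<open>r\<close> up to a factor, as
  \<open>r\<close> is proportional to the vector of the \<open>1 / x\<^sub>i\<close>; the condition \<open>gcd r = 1\<close> fixes the factor.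
\<close>

text \<open>Needed twice: to compare the scale factors of two proportional vectors, and to see that
  dividing a vector by its gcd leaves coprime entries.\<close>

lemma Gcd_range_mult:
  fixes f :: "'a \<Rightarrow> nat"
  shows "Gcd (range (\<lambda>i. c * f i)) = c * Gcd (range f)"
  using Gcd_mult[of c "range f"] by (simp add: image_image)

lemma mK_equation_iff:
  fixes r d :: "nat ^ 'n::finite"
  shows "r $ i * d $ i = m * (\<Sum>j\<in>UNIV - {i}. r $ j) \<longleftrightarrow>
    r $ i * (d $ i + m) = m * (\<Sum>j\<in>UNIV. r $ j)"
proof -
  have "(\<Sum>j\<in>UNIV. r $ j) = r $ i + (\<Sum>j\<in>UNIV - {i}. r $ j)"
    by (simp add: sum.remove)
  then show ?thesis by (simp add: algebra_simps)
qed

lemma arithmetical_structures_mK_iff: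
  fixes r d :: "nat ^ 'n::finite"
  shows "(r, d) \<in> arithmetical_structures_mK m \<longleftrightarrow>
    (\<forall>i. r $ i > 0) \<and> (\<forall>i. d $ i > 0) \<and> Gcd (range (\<lambda>i. r $ i)) = 1 \<and>
    (\<forall>i. r $ i * (d $ i + m) = m * (\<Sum>j\<in>UNIV. r $ j))"
  by (simp add: arithmetical_structures_mK_def mK_equation_iff)

lemma sum_vec_pos:
  fixes r :: "nat ^ 'n::finite"
  assumes "\<And>i. r $ i > 0"
  shows "(\<Sum>j\<in>UNIV. r $ j) > 0"
  using assms by (intro sum_pos) auto

lemma structure_imp_egyptian:
  fixes r d :: "nat ^ 'n::finite"
  assumes "m > 0" and "(r, d) \<in> arithmetical_structures_mK m"
  shows "(\<chi> i. d $ i + m) \<in> egyptian_solutions m"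
proof -
  define S where "S = (\<Sum>j\<in>UNIV. r $ j)"
  have eq: "r $ i * (d $ i + m) = m * S" and "r $ i > 0" for i
    using assms(2) by (auto simp: arithmetical_structures_mK_iff S_def)
  then have S: "S > 0" unfolding S_def by (intro sum_vec_pos)
  have "1 / real (d $ i + m) = real (r $ i) / (real m * real S)" for i
  proof -
    have "real (r $ i) * real (d $ i + m) = real m * real S"
      by (metis eq of_nat_mult)
    then show ?thesis using S assms(1) by (simp add: field_simps)
  qed
  then have "(\<Sum>i\<in>UNIV. 1 / real (d $ i + m)) = real S / (real m * real S)"
    by (simp add: S_def flip: sum_divide_distrib)
  then show ?thesis using S assms(1) by (simp add: egyptian_solutions_def)
qed

lemma structure_unique:
  fixes r r' d :: "nat ^ 'n::finite"
  assumes "m > 0"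
    and "(r, d) \<in> arithmetical_structures_mK m" and "(r', d) \<in> arithmetical_structures_mK m"
  shows "r = r'"
proof -
  define S where "S = (\<Sum>j\<in>UNIV. r $ j)"
  define S' where "S' = (\<Sum>j\<in>UNIV. r' $ j)"
  have r: "r $ i * (d $ i + m) = m * S" "r $ i > 0" "Gcd (range (\<lambda>i. r $ i)) = 1"
    and r': "r' $ i * (d $ i + m) = m * S'" "Gcd (range (\<lambda>i. r' $ i)) = 1" for i
    using assms(2,3) by (auto simp: arithmetical_structures_mK_iff S_def S'_def)
  have proportional: "S' * r $ i = S * r' $ i" for i
  proof -
    \<comment> \<open>Both sides equal \<open>m * S * S'\<close>. The common factor
      \<open>d $ i + m\<close> can be cancelled because m > 0.\<close>
    have "(S' * r $ i) * (d $ i + m) = (S * r' $ i) * (d $ i + m)"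
      using r(1)[of i] r'(1)[of i] by (metis mult.assoc mult.commute)
    then show ?thesis using assms(1) by simp
  qed
  \<comment> \<open>Take the gcd over all i in \<open>proportional\<close>; both gcds are 1, so the
    two sums agree.\<close>
  have "S' * Gcd (range (\<lambda>i. r $ i)) = S * Gcd (range (\<lambda>i. r' $ i))"
    by (simp only: proportional flip: Gcd_range_mult)
  then have "S' = S" using r(3) r'(2) by simp
  moreover have "S > 0" using r(2) unfolding S_def by (intro sum_vec_pos)
  ultimately show ?thesis using proportional by (simp add: vec_eq_iff)
qed

text \<open>Surjectivity: clearing denominators in the vector of the 1 / x_i and dividing by the gcd
  gives r, while d_i is x_i - m. Having at least two vertices makes d_i positive.\<close>

lemma egyptian_imp_structure:
  fixes x :: "nat ^ 'n::finite"
  assumes "m > 0" and "CARD('n) \<ge> 2" and "x \<in> egyptian_solutions m"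
  obtains r d where "(r, d) \<in> arithmetical_structures_mK m" and "x = (\<chi> i. d $ i + m)"
proof -
  have x: "x $ i > 0" and sum_x: "(\<Sum>i\<in>UNIV. 1 / real (x $ i)) = 1 / real m" for i
    using assms(3) by (auto simp: egyptian_solutions_def)
  \<comment> \<open>Any positive common multiple of the x_i would do: it makes \<open>q i\<close>,
    which is L / x_i, an integer.\<close>
  define L where "L = (\<Prod>i\<in>UNIV. x $ i)"
  define q where "q i = L div x $ i" for i
  define g where "g = Gcd (range q)"
  define r :: "nat ^ 'n" where "r = (\<chi> i. q i div g)"
  define S where "S = (\<Sum>j\<in>UNIV. r $ j)"
  have L: "L > 0" unfolding L_def using x by (simp add: prod_pos)
  have q: "q i * x $ i = L" for i
    unfolding q_def L_def by (intro dvd_div_mult_self dvd_prodI) auto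
  have gr: "g * r $ i = q i" for i
    by (simp add: r_def g_def Gcd_dvd)
  \<comment> \<open>Both are factors of \<open>g * r $ i * x $ i = L\<close>, which is
    positive.\<close>
  have pos: "g > 0" "r $ i > 0" for i
    using gr[of i] q[of i] L by (metis mult_is_0 neq0_conv)+
  have "g * Gcd (range (\<lambda>i. r $ i)) = g"
    unfolding Gcd_range_mult[symmetric] gr by (simp add: g_def)
  then have gcd_r: "Gcd (range (\<lambda>i. r $ i)) = 1" using pos by simp
  have "real (q i) = real L * (1 / real (x $ i))" for i
    using q[of i] x[of i] by (simp add: field_simps flip: of_nat_mult)
  then have "real (\<Sum>i\<in>UNIV. q i) = real L * (\<Sum>i\<in>UNIV. 1 / real (x $ i))"
    by (simp add: sum_distrib_left)
  \<comment> \<open>The Egyptian fraction equation multiplied by \<open>m * L\<close>; it now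
    involves integers only and can be pulled back to the naturals.\<close>
  then have "real (m * (\<Sum>i\<in>UNIV. q i)) = real L"
    unfolding of_nat_mult using assms(1) by (simp add: sum_x)
  then have "m * (\<Sum>i\<in>UNIV. q i) = L" by (simp only: of_nat_eq_iff)
  then have "g * (m * S) = L"
    by (simp add: S_def mult.left_commute sum_distrib_left flip: gr)
  then have "g * (r $ i * x $ i) = g * (m * S)" for i
    using q[of i] by (simp flip: gr)
  then have rx: "r $ i * x $ i = m * S" for i
    using pos by simp
  \<comment> \<open>A second vertex contributes a positive entry, so r_i < S and hence r_i m < m S =
    r_i x_i.\<close>
  have x_gt: "x $ i > m" for i
  proof -
    have "UNIV - {i} \<noteq> {}"
    proof
      assume "UNIV - {i} = {}"
      then have "CARD('n) \<le> card {i}" by (intro card_mono) auto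
      then show False using assms(2) by simp
    qed
    then have "(\<Sum>j\<in>UNIV - {i}. r $ j) > 0" using pos by (intro sum_pos) auto
    then have "r $ i < S" unfolding S_def by (simp add: sum.remove[of UNIV i])
    then have "r $ i * m < r $ i * x $ i"
      using assms(1) by (simp add: rx mult.commute)
    then show ?thesis by simp
  qed
  show thesis
  proof (rule that)
    \<comment> \<open>Subtraction on naturals truncates; \<open>x_gt\<close> ensures that x_i - m is
      the true difference and is positive.\<close>
    show "(r, \<chi> i. x $ i - m) \<in> arithmetical_structures_mK m"
      using pos gcd_r x_gt rx
      by (simp add: arithmetical_structures_mK_iff S_def less_imp_le)
    show "x = (\<chi> i. (\<chi> i. x $ i - m) $ i + m)"
      using x_gt by (simp add: vec_eq_iff less_imp_le)
  qed
qed

theorem theorem4p4: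
  fixes m :: nat
  assumes "m > 0" and "CARD('n::finite) \<ge> 2"
  shows "bij_betw (\<lambda>(r :: nat ^ 'n, d :: nat ^ 'n). (\<chi> i. d $ i + m) :: nat ^ 'n)
           (arithmetical_structures_mK m) (egyptian_solutions m)"
proof (rule bij_betw_imageI)
  show "inj_on (\<lambda>(r :: nat ^ 'n, d :: nat ^ 'n). (\<chi> i. d $ i + m) :: nat ^ 'n)
      (arithmetical_structures_mK m)"
  proof (rule inj_onI, clarify)
    fix r d r' d' :: "nat ^ 'n"
    assume s: "(r, d) \<in> arithmetical_structures_mK m" "(r', d') \<in> arithmetical_structures_mK m"
      and "(\<chi> i. d $ i + m) = (\<chi> i. d' $ i + m)"
    then have "d = d'" by (simp add: vec_eq_iff)
    with s show "r = r' \<and> d = d'" using structure_unique[OF assms(1)] by blast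
  qed
  show "(\<lambda>(r :: nat ^ 'n, d :: nat ^ 'n). (\<chi> i. d $ i + m) :: nat ^ 'n)
      ` arithmetical_structures_mK m = egyptian_solutions m"
  proof
    show "(\<lambda>(r :: nat ^ 'n, d :: nat ^ 'n). (\<chi> i. d $ i + m) :: nat ^ 'n)
        ` arithmetical_structures_mK m \<subseteq> egyptian_solutions m"
      using structure_imp_egyptian[OF assms(1)] by auto
    show "egyptian_solutions m \<subseteq> (\<lambda>(r :: nat ^ 'n, d :: nat ^ 'n). (\<chi> i. d $ i + m) :: nat ^ 'n)
        ` arithmetical_structures_mK m"
    proof
      fix x :: "nat ^ 'n"
      assume "x \<in> egyptian_solutions m"
      then obtain r d where "(r, d) \<in> arithmetical_structures_mK m" and "x = (\<chi> i. d $ i + m)"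
        using egyptian_imp_structure[OF assms] by blast
      then show "x \<in> (\<lambda>(r :: nat ^ 'n, d :: nat ^ 'n). (\<chi> i. d $ i + m) :: nat ^ 'n)
          ` arithmetical_structures_mK m"
        by (intro image_eqI[where x = "(r, d)"]) simp_all
    qed
  qed
qed

end
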